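(* Let $N\ge2$, $1\le k<N$, $C=[0,\infty)^N$, and let $T:C\to C$ be given by $T_i(x)=x_if_i(x)$, $i=1,\dots,N$, where $f\in C^1(C,C)$ with $f_i(x)>0$ for all $x\in C$ and all $i$. Let $r\in\dot C$. Assume that: (a) the system $x(n)=T^n(x)$ is a type-K competitive system; (b) $T([\mathbf 0,r])$ is type-K convex; (c) the spectral radius of $M(x)=\left(-\frac{x_i}{f_i(x)}\frac{\partial f_i}{\partial x_j}(x)\right)_{N\times N}$ satisfies $\rho(M(x))<1$ for all $x\in[\mathbf 0,r]$. Then $T:[\mathbf 0,r]\to T([\mathbf 0,r])$ is a homeomorphism and a weakly type-K retrotone map (on $[\mathbf 0,r]$). If, in addition, $\frac{\partial f_i(x)}{\partial x_j}\ne0$ for all $i,j\in\{1,\dots,N\}$ and all $x\in[\mathbf 0,r]$, then $T$ is type-K retrotone (on $[\mathbf 0,r]$).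
   Context: Notation: $\dot C=(0,\infty)^N$; $[\mathbf 0,r]=\{z\in\mathbb R^N:0\le z_i\le r_i\ \forall i\}$; $H=\{1,\dots,k\}$, $V=\{k+1,\dots,N\}$. $K=\{p\in\mathbb R^N:p_i\ge0\ \forall i\in H,\ p_j\le0\ \forall j\in V\}$; $x\le_K y$ means $y-x\in K$, and $x<_K y$ means $x\le_K y$ and $x\ne y$. The system is type-K competitive (with respect to $k$) if for all $x\in C$ the Jacobian $Df(x)=(\partial f_i/\partial x_j)$ has block form $\begin{pmatrix}A_1 & B_1 \\ B_2 & A_2\end{pmatrix}$, where $A_1$ ($k\times k$) and $A_2$ ($(N-k)\times(N-k)$) have nonpositive entries with each diagonal entry negative, and $B_1,B_2$ have nonnegative entries. A set $S$ is type-K convex if for any distinct $x,y\in S$ with $x<_K y$, the line segment $\overline{xy}=\{tx+(1-t)y:0\le t\le1\}$ is contained in $S$. $T$ is type-K retrotone on $X\subset C$ if for any $x,y\in X$, $T(x)<_K T(y)$ implies $x<_K y$ and, for each $i\in H$ and $j\in V$, if $y_i\ne0$ then $x_i<y_i$, and if $x_j\ne0$ then $x_j>y_j$. $T$ is weakly type-K retrotone on $X\subset C$ if for any $x,y\in X$, $T(x)<_K T(y)$ implies $x<_K y$ and, for each $i\in H$ and $j\in V$, if $T_i(x)<T_i(y)$ then $x_i<y_i$, and if $T_j(x)>T_j(y)$ then $x_j>y_j$. *)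

theory Defs
  imports "HOL-Analysis.Analysis"
begin

definition nonneg_orthant :: "(real ^ 'n) set" where
  "nonneg_orthant = {x. \<forall>i. 0 \<le> x $ i}"

definition pos_orthant :: "(real ^ 'n) set" where
  "pos_orthant = {x. \<forall>i. 0 < x $ i}"

definition order_box :: "real ^ 'n \<Rightarrow> (real ^ 'n) set" where
  "order_box r = {z. \<forall>i. 0 \<le> z $ i \<and> z $ i \<le> r $ i}"

text \<open>The ordered index type \<open>'n\<close> plays the role of \<open>1 < 2 < \<dots> < N\<close>, the position of \<open>i\<close>
  being \<open>card {..i}\<close>. The block \<open>V\<close> is always the complement of \<open>H\<close>.\<close>

definition first_indices :: "nat \<Rightarrow> 'n :: {finite, linorder} set" where
  "first_indices k = {i. card {..i} \<le> k}"

definition cone_K :: "'n set \<Rightarrow> (real ^ 'n) set" where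
  "cone_K H = {p. (\<forall>i\<in>H. 0 \<le> p $ i) \<and> (\<forall>j\<in>-H. p $ j \<le> 0)}"

definition le_K :: "'n::finite set \<Rightarrow> real ^ 'n \<Rightarrow> real ^ 'n \<Rightarrow> bool" where
  "le_K H x y \<longleftrightarrow> y - x \<in> cone_K H"

definition less_K :: "'n::finite set \<Rightarrow> real ^ 'n \<Rightarrow> real ^ 'n \<Rightarrow> bool" where
  "less_K H x y \<longleftrightarrow> le_K H x y \<and> x \<noteq> y"

text \<open>On the closed orthant, derivatives are taken relative to the orthant, hence one-sided at
  its boundary.\<close>

definition orthant_jacobian :: "(real ^ 'n \<Rightarrow> real ^ 'n) \<Rightarrow> real ^ 'n \<Rightarrow> real ^ 'n ^ 'n::finite" where
  "orthant_jacobian f x = jacobian f (at x within nonneg_orthant)"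

definition C1_on_orthant :: "(real ^ 'n::finite \<Rightarrow> real ^ 'n) \<Rightarrow> bool" where
  "C1_on_orthant f \<longleftrightarrow>
     f differentiable_on nonneg_orthant \<and> continuous_on nonneg_orthant (orthant_jacobian f)"

definition type_K_competitive :: "'n::finite set \<Rightarrow> (real ^ 'n \<Rightarrow> real ^ 'n) \<Rightarrow> bool" where
  "type_K_competitive H f \<longleftrightarrow>
     (\<forall>x\<in>nonneg_orthant.
        (\<forall>i\<in>H. \<forall>j\<in>H. orthant_jacobian f x $ i $ j \<le> 0) \<and>
        (\<forall>i\<in>-H. \<forall>j\<in>-H. orthant_jacobian f x $ i $ j \<le> 0) \<and>
        (\<forall>i. orthant_jacobian f x $ i $ i < 0) \<and>
        (\<forall>i\<in>H. \<forall>j\<in>-H. 0 \<le> orthant_jacobian f x $ i $ j) \<and>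
        (\<forall>i\<in>-H. \<forall>j\<in>H. 0 \<le> orthant_jacobian f x $ i $ j))"

definition type_K_convex :: "'n::finite set \<Rightarrow> (real ^ 'n) set \<Rightarrow> bool" where
  "type_K_convex H S \<longleftrightarrow> (\<forall>x\<in>S. \<forall>y\<in>S. less_K H x y \<longrightarrow> closed_segment x y \<subseteq> S)"

definition type_K_retrotone_on ::
    "'n::finite set \<Rightarrow> (real ^ 'n) set \<Rightarrow> (real ^ 'n \<Rightarrow> real ^ 'n) \<Rightarrow> bool" where
  "type_K_retrotone_on H X T \<longleftrightarrow>
     (\<forall>x\<in>X. \<forall>y\<in>X. less_K H (T x) (T y) \<longrightarrow>
        less_K H x y \<and>
        (\<forall>i\<in>H. y $ i \<noteq> 0 \<longrightarrow> x $ i < y $ i) \<and>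
        (\<forall>j\<in>-H. x $ j \<noteq> 0 \<longrightarrow> x $ j > y $ j))"

definition weakly_type_K_retrotone_on ::
    "'n::finite set \<Rightarrow> (real ^ 'n) set \<Rightarrow> (real ^ 'n \<Rightarrow> real ^ 'n) \<Rightarrow> bool" where
  "weakly_type_K_retrotone_on H X T \<longleftrightarrow>
     (\<forall>x\<in>X. \<forall>y\<in>X. less_K H (T x) (T y) \<longrightarrow>
        less_K H x y \<and>
        (\<forall>i\<in>H. T x $ i < T y $ i \<longrightarrow> x $ i < y $ i) \<and>
        (\<forall>j\<in>-H. T x $ j > T y $ j \<longrightarrow> x $ j > y $ j))"

definition complex_spectrum :: "real ^ 'n ^ 'n \<Rightarrow> complex set" where
  "complex_spectrum A =
     {c. \<exists>v :: complex ^ 'n. v \<noteq> 0 \<and> (\<chi> i j. complex_of_real (A $ i $ j)) *v v = c *s v}"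

definition spectral_radius :: "real ^ 'n ^ 'n \<Rightarrow> real" where
  "spectral_radius A = (SUP c\<in>complex_spectrum A. cmod c)"

definition matrix_M :: "(real ^ 'n \<Rightarrow> real ^ 'n) \<Rightarrow> real ^ 'n \<Rightarrow> real ^ 'n ^ 'n::finite" where
  "matrix_M f x = (\<chi> i j. - (x $ i / f x $ i) * orthant_jacobian f x $ i $ j)"

end

theory Submission
  imports Defs
begin

text \<open>The derivative of \<open>T\<close> is \<open>diag f (I - M)\<close>. Flipping the signs of the coordinates in \<open>V\<close> turns
  \<open>\<le>\<^sub>K\<close> into the componentwise order and, by competitiveness, \<open>M\<close> into a nonnegative matrix \<open>P\<close>. Since
  \<open>P\<close> has no real eigenvalue in \<open>[1,\<infinity>)\<close>, \<open>(I - P) u = 1\<close> has a positive solution, so the derivative of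
  the flipped map \<open>G\<close> is an M-matrix at every point of the box. As in the theorem of Gale and Nikaido for
  Leontief type Jacobians, \<open>G x \<le> G y\<close> then implies \<open>x \<le> y\<close>. This gives injectivity and the order
  part of retrotonicity; the strict inequalities follow from the mean
  value theorem, because a coordinate in which \<open>x\<close> and \<open>y\<close> agree can only decrease under \<open>G\<close>.\<close>

section \<open>Resolvent of a nonnegative matrix\<close>

lemma continuous_on_det:
  fixes A :: "'a::topological_space \<Rightarrow> real ^ 'n ^ 'n"
  assumes "\<And>i j. continuous_on S (\<lambda>t. A t $ i $ j)"
  shows "continuous_on S (\<lambda>t. det (A t))"
  unfolding det_def by (intro continuous_intros assms)

text \<open>Homotopy in \<open>t\<close> from \<open>mat 1\<close> to \<open>mat 1 - P\<close>: a
  kernel vector of \<open>mat 1 - t *\<^sub>R P\<close> with \<open>t > 0\<close> would be an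
  eigenvector of \<open>P\<close> for \<open>1 / t \<ge> 1\<close>. So the solution of
  \<open>u = 1 + t P u\<close> exists and varies continuously up to \<open>t = 1\<close>, and it
  keeps the positivity it has at \<open>t = 0\<close>.\<close>

lemma nonneg_matrix_resolvent:
  fixes P :: "real ^ 'n ^ 'n"
  assumes nonneg: "\<And>i j. 0 \<le> P $ i $ j"
    and no_eigenvalue: "\<And>c v. 1 \<le> c \<Longrightarrow> P *v v = c *s v \<Longrightarrow> v = 0"
  obtains u where "\<And>i. 0 < u $ i" and "u - P *v u = 1"
proof -
  define A where "A t = mat 1 - t *\<^sub>R P" for t :: real
  have A_mult: "A t *v v = v - t *\<^sub>R (P *v v)" for t v
    by (simp add: A_def matrix_vector_mult_diff_rdistrib scaleR_matrix_vector_assoc)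
  have det_nz: "det (A t) \<noteq> 0" if t: "t \<in> {0..1}" for t
  proof -
    have "v = 0" if "A t *v v = 0" for v
    proof (cases "t = 0")
      case True
      with that show ?thesis by (simp add: A_mult)
    next
      case False
      have "v = t *\<^sub>R (P *v v)"
        using that by (simp add: A_mult)
      then have "P *v v = (1 / t) *s v"
        using False by (metis divide_inverse_commute mult.right_neutral scalar_mult_eq_scaleR
            scaleR_scaleR divide_self_if scaleR_one mult.commute inverse_eq_divide)
      moreover have "1 \<le> 1 / t"
        using t False by (simp add: divide_simps)
      ultimately show ?thesis
        using no_eigenvalue by blast
    qed
    then show ?thesis
      by (metis invertible_det_nz invertible_left_inverse matrix_left_invertible_ker)
  qed
  \<comment> \<open>Cramer's rule: as a quotient of determinants the solution is visibly continuous
    in \<open>t\<close>.\<close>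
  define u where
    "u t = (\<chi> k. det (\<chi> i j. if j = k then (1 :: real ^ 'n) $ i else A t $ i $ j) / det (A t))" for t
  have A_u: "A t *v u t = 1" if "t \<in> {0..1}" for t
    using cramer[OF det_nz[OF that], of "u t" 1] by (simp add: u_def)
  have cont_A: "continuous_on {0..1} (\<lambda>t. A t $ i $ j)" for i j
    unfolding A_def by (simp, intro continuous_intros)
  have cont_u: "continuous_on {0..1} u"
    unfolding u_def
  proof (intro continuous_on_vec_lambda continuous_on_divide continuous_on_det ballI)
    fix i j k :: 'n
    show "continuous_on {0..1} (\<lambda>t. (\<chi> i j. if j = k then (1 :: real ^ 'n) $ i else A t $ i $ j) $ i $ j)"
      using cont_A by (cases "j = k") auto
  qed (use cont_A det_nz in auto)
  define Q where "Q = {0..1} \<inter> u -` {x. \<forall>i. 0 < x $ i}"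
  \<comment> \<open>A nonnegative solution of \<open>u = 1 + t P u\<close> is already at least \<open>1\<close>, so the set of \<open>t\<close> with
    \<open>u t\<close> positive is both open and closed in \<open>[0,1]\<close>.\<close>
  have Q_closed_form: "Q = {0..1} \<inter> u -` {x. \<forall>i. 0 \<le> x $ i}"
  proof (rule antisym)
    show "{0..1} \<inter> u -` {x. \<forall>i. 0 \<le> x $ i} \<subseteq> Q"
    proof
      fix t assume t: "t \<in> {0..1} \<inter> u -` {x. \<forall>i. 0 \<le> x $ i}"
      have "0 < u t $ i" for i
      proof -
        have "0 \<le> (P *v u t) $ i"
          unfolding matrix_vector_mult_def using t nonneg by (auto intro!: sum_nonneg)
        moreover have "u t $ i = 1 + t * (P *v u t) $ i"
          using arg_cong[OF A_u, of t "\<lambda>w. w $ i"] t by (simp add: A_mult)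
        ultimately show ?thesis
          using t by (auto intro!: add_pos_nonneg)
      qed
      then show "t \<in> Q" using t by (simp add: Q_def)
    qed
  qed (auto simp: Q_def less_imp_le)
  have "open {x :: real ^ 'n. \<forall>i. 0 < x $ i}"
    unfolding Collect_all_eq by (intro open_INT ballI open_halfspace_component_gt_cart) simp
  then have "openin (top_of_set {0..1}) Q"
    unfolding Q_def by (rule continuous_openin_preimage_gen[OF cont_u])
  moreover have "closed {x :: real ^ 'n. \<forall>i. 0 \<le> x $ i}"
    by (intro closed_Collect_all closed_halfspace_component_ge_cart)
  then have "closedin (top_of_set {0..1}) Q"
    unfolding Q_closed_form by (rule continuous_closedin_preimage[OF cont_u])
  moreover have "0 \<in> Q"
    using A_u[of 0] by (simp add: Q_def A_mult)
  moreover have "connected {0..1 :: real}"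
    by simp
  ultimately have "Q = {0..1}"
    unfolding connected_clopen by blast
  then have "1 \<in> Q"
    by simp
  then show thesis
    using that[of "u 1"] A_u[of 1] by (simp add: Q_def A_mult)
qed

section \<open>Real eigenvalues and the spectral radius\<close>

text \<open>A real supremum dominates its elements only if the set is bounded above; here any
  operator bound \<open>K\<close> of the complexified matrix bounds the moduli of its
  eigenvalues.\<close>

lemma cmod_le_spectral_radius:
  fixes A :: "real ^ 'n ^ 'n"
  assumes "c \<in> complex_spectrum A"
  shows "cmod c \<le> spectral_radius A"
proof -
  define B where "B = (\<chi> i j. complex_of_real (A $ i $ j))"
  have "bounded_linear ((*v) B)"
    by (simp add: linear_linear)
  then obtain K where K: "\<And>v. norm (B *v v) \<le> norm v * K"
    using bounded_linear.bounded by blast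
  have "cmod d \<le> K" if "d \<in> complex_spectrum A" for d
  proof -
    obtain v where v: "v \<noteq> 0" "B *v v = d *s v"
      using \<open>d \<in> complex_spectrum A\<close> unfolding complex_spectrum_def B_def by blast
    have "norm (d *s v) = cmod d * norm v"
      unfolding norm_vec_def by (simp add: norm_mult L2_set_right_distrib)
    then show ?thesis
      using K[of v] v by (simp add: mult.commute)
  qed
  then have "bdd_above (cmod ` complex_spectrum A)"
    by (intro bdd_aboveI[of _ K]) auto
  then show ?thesis
    unfolding spectral_radius_def using assms by (rule cSUP_upper[rotated])
qed

lemma real_eigenvalue_in_complex_spectrum:
  fixes A :: "real ^ 'n ^ 'n"
  assumes "A *v v = c *s v" and "v \<noteq> 0"
  shows "complex_of_real c \<in> complex_spectrum A"
proof -
  define w where "w = (\<chi> i. complex_of_real (v $ i))"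
  have "(\<Sum>j\<in>UNIV. A $ i $ j * v $ j) = c * v $ i" for i
    using arg_cong[OF assms(1), of "\<lambda>x. x $ i"] by (simp add: matrix_vector_mult_def)
  then have "(\<chi> i j. complex_of_real (A $ i $ j)) *v w = complex_of_real c *s w"
    by (simp add: w_def matrix_vector_mult_def vec_eq_iff flip: of_real_mult of_real_sum)
  moreover have "w \<noteq> 0"
    using assms(2) by (auto simp: w_def vec_eq_iff)
  ultimately show ?thesis
    unfolding complex_spectrum_def by blast
qed

section \<open>Maps with M-matrix derivative on a box\<close>

text \<open>Semipositivity, i.e. a positive vector with positive image, is the characterisation of nonsingular
  M-matrices that passes to principal submatrices without inverting anything.\<close>

definition M_matrix :: "real ^ 'n ^ 'n \<Rightarrow> bool" where
  "M_matrix A \<longleftrightarrow> (\<forall>i j. i \<noteq> j \<longrightarrow> A $ i $ j \<le> 0) \<and>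
     (\<exists>u. (\<forall>i. 0 < u $ i) \<and> (\<forall>i. 0 < (A *v u) $ i))"

text \<open>One-variable mean value theorem for a coordinate of \<open>G\<close> along the segment.
  The point \<open>z\<close> depends on \<open>i\<close>, as there is no mean value equality for all
  coordinates at once.\<close>

lemma box_mean_value:
  fixes G :: "real ^ 'n \<Rightarrow> real ^ 'n"
  assumes deriv: "\<And>x. x \<in> cbox a b \<Longrightarrow> (G has_derivative (\<lambda>h. A x *v h)) (at x within cbox a b)"
    and x: "x \<in> cbox a b" and y: "y \<in> cbox a b"
  obtains z where "z \<in> closed_segment x y" and "G y $ i - G x $ i = (A z *v (y - x)) $ i"
proof -
  define p where "p t = x + t *\<^sub>R (y - x)" for t :: real
  have p_seg: "p t \<in> closed_segment x y" if "t \<in> {0..1}" for t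
    using that unfolding p_def in_segment by (intro exI[of _ t]) (auto simp: algebra_simps)
  have seg_box: "closed_segment x y \<subseteq> cbox a b"
    using x y by (simp add: closed_segment_subset)
  have "((\<lambda>t. G (p t) $ i) has_derivative (\<lambda>h. (A (p t) *v (h *\<^sub>R (y - x))) $ i)) (at t within {0..1})"
    if t: "t \<in> {0..1}" for t
  proof -
    have "(G has_derivative (\<lambda>h. A (p t) *v h)) (at (p t) within p ` {0..1})"
      using t p_seg seg_box by (intro has_derivative_subset[OF deriv]) auto
    moreover have "(p has_derivative (\<lambda>h. h *\<^sub>R (y - x))) (at t within {0..1})"
      unfolding p_def by (auto intro!: derivative_eq_intros)
    ultimately have "((\<lambda>t. G (p t)) has_derivative (\<lambda>h. A (p t) *v (h *\<^sub>R (y - x)))) (at t within {0..1})"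
      by (rule has_derivative_in_compose[rotated])
    then show ?thesis
      by (rule bounded_linear.has_derivative[OF bounded_linear_vec_nth])
  qed
  then obtain t where "t \<in> {0..1}"
    and "G (p 1) $ i - G (p 0) $ i = (A (p t) *v ((1 - 0) *\<^sub>R (y - x))) $ i"
    using mvt_very_simple[of 0 1 "\<lambda>t. G (p t) $ i" "\<lambda>t h. (A (p t) *v (h *\<^sub>R (y - x))) $ i"]
    by auto
  then show thesis
    using that[of "p t"] p_seg by (simp add: p_def)
qed

text \<open>In row \<open>i\<close> of the mean value formula the diagonal entry meets
  \<open>y $ i - x $ i = 0\<close>; all other entries are nonpositive and meet nonnegative
  increments.\<close>

lemma box_off_diagonal_antitone:
  fixes G :: "real ^ 'n \<Rightarrow> real ^ 'n"
  assumes deriv: "\<And>x. x \<in> cbox a b \<Longrightarrow> (G has_derivative (\<lambda>h. A x *v h)) (at x within cbox a b)"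
    and off_diag: "\<And>x i j. x \<in> cbox a b \<Longrightarrow> i \<noteq> j \<Longrightarrow> A x $ i $ j \<le> 0"
    and x: "x \<in> cbox a b" and y: "y \<in> cbox a b" and le: "x \<le> y" and eq: "x $ i = y $ i"
  shows "G y $ i \<le> G x $ i"
proof -
  obtain z where z: "z \<in> closed_segment x y" "G y $ i - G x $ i = (A z *v (y - x)) $ i"
    using box_mean_value[OF deriv x y] by blast
  have "z \<in> cbox a b"
    using z(1) x y by (meson closed_segment_subset convex_box(1) subsetD)
  then have "A z $ i $ j * (y - x) $ j \<le> 0" for j
    using off_diag le eq by (cases "j = i") (auto simp: less_eq_vec_def mult_nonpos_nonneg)
  then have "(A z *v (y - x)) $ i \<le> 0"
    unfolding matrix_vector_mult_def vec_lambda_beta by (rule sum_nonpos)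
  then show ?thesis
    using z(2) by linarith
qed

text \<open>Quantifies that an M-matrix sends no nonzero \<open>v \<ge> 0\<close> to a nonpositive
  vector; the margin \<open>\<delta>\<close> later absorbs the linearisation error.\<close>

lemma M_matrix_image_pos:
  fixes A :: "real ^ 'n ^ 'n"
  assumes "M_matrix A"
  obtains \<delta> where "0 < \<delta>" and "\<And>v. 0 \<le> v \<Longrightarrow> \<exists>i. \<delta> * norm v \<le> (A *v v) $ i"
proof -
  obtain u where u: "\<And>i. 0 < u $ i" "\<And>i. 0 < (A *v u) $ i"
    using assms unfolding M_matrix_def by blast
  define m where "m = Min (range (($) (A *v u)))"
  have m: "0 < m" "\<And>i. m \<le> (A *v u) $ i"
    using u(2) by (auto simp: m_def)
  have "u \<noteq> 0"
    using u(1) by (metis less_irrefl zero_index)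
  \<comment> \<open>From \<open>v \<le> c *\<^sub>R u\<close> comes
    \<open>norm v \<le> c * norm u\<close>, while the touching row has value at least
    \<open>c * m\<close>; hence the constant.\<close>
  have "\<exists>i. m / norm u * norm v \<le> (A *v v) $ i" if v: "0 \<le> v" for v
  proof -
    \<comment> \<open>Pick the row where \<open>v\<close> first touches a multiple of \<open>u\<close>.\<close>
    define c where "c = Max (range (\<lambda>i. v $ i / u $ i))"
    have "c \<in> range (\<lambda>i. v $ i / u $ i)"
      unfolding c_def by (intro Max_in) auto
    then obtain i where i: "v $ i = c * u $ i"
      using u(1) by (metis (no_types, lifting) imageE less_irrefl nonzero_eq_divide_eq)
    have "v $ j / u $ j \<le> c" for j
      by (simp add: c_def)
    then have v_le: "v $ j \<le> c * u $ j" for j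
      using u(1) by (simp add: pos_divide_le_eq)
    have "0 \<le> c * u $ i"
      using v i by (metis less_eq_vec_def zero_index)
    then have "0 \<le> c"
      using u(1)[of i] by (simp add: zero_le_mult_iff)
    have "norm v \<le> norm (c *\<^sub>R u)"
    proof (rule norm_le_componentwise_cart)
      show "norm (v $ j) \<le> norm ((c *\<^sub>R u) $ j)" for j
        using v_le[of j] v by (simp add: less_eq_vec_def)
    qed
    then have "m / norm u * norm v \<le> c * m"
      using \<open>0 \<le> c\<close> \<open>u \<noteq> 0\<close> m(1) by (simp add: field_simps)
    also have "\<dots> \<le> c * (A *v u) $ i"
      using m \<open>0 \<le> c\<close> by (simp add: mult_left_mono)
    also have "\<dots> = (\<Sum>j\<in>UNIV. A $ i $ j * (c * u $ j))"
      by (simp add: matrix_vector_mult_def sum_distrib_left algebra_simps)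
    also have "\<dots> \<le> (\<Sum>j\<in>UNIV. A $ i $ j * v $ j)"
    proof (rule sum_mono)
      show "A $ i $ j * (c * u $ j) \<le> A $ i $ j * v $ j" for j
        using i v_le assms by (cases "i = j") (auto simp: M_matrix_def mult_left_mono_neg)
    qed
    finally show ?thesis
      by (auto simp: matrix_vector_mult_def)
  qed
  then show thesis
    using m(1) \<open>u \<noteq> 0\<close> by (intro that[of "m / norm u"]) auto
qed

text \<open>Near \<open>y\<close> the linearisation error is at most half the margin
  \<open>\<delta> * norm (x - y)\<close>, so some coordinate of \<open>G x - G y\<close> is positive
  unless \<open>x = y\<close>.\<close>

lemma M_matrix_locally_inverse_isotone:
  fixes G :: "real ^ 'n \<Rightarrow> real ^ 'n"
  assumes deriv: "(G has_derivative (\<lambda>h. A *v h)) (at y within S)" and A: "M_matrix A"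
  obtains e where "0 < e"
    and "\<And>x. x \<in> S \<Longrightarrow> y \<le> x \<Longrightarrow> G x \<le> G y \<Longrightarrow> norm (x - y) < e \<Longrightarrow> x = y"
proof -
  obtain \<delta> where \<delta>: "0 < \<delta>" "\<And>v. 0 \<le> v \<Longrightarrow> \<exists>i. \<delta> * norm v \<le> (A *v v) $ i"
    using M_matrix_image_pos[OF A] by blast
  obtain e where e: "0 < e" "\<And>x. x \<in> S \<Longrightarrow> norm (x - y) < e \<Longrightarrow>
      norm (G x - G y - A *v (x - y)) \<le> \<delta> / 2 * norm (x - y)"
    using deriv \<delta>(1) unfolding has_derivative_within_alt by (meson half_gt_zero)
  have "x = y" if x: "x \<in> S" "y \<le> x" "G x \<le> G y" "norm (x - y) < e" for x
  proof -
    obtain i where i: "\<delta> * norm (x - y) \<le> (A *v (x - y)) $ i"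
      using \<delta>(2)[of "x - y"] x(2) by (auto simp: less_eq_vec_def)
    have "\<bar>(G x - G y - A *v (x - y)) $ i\<bar> \<le> \<delta> / 2 * norm (x - y)"
      using component_le_norm_cart e(2)[OF x(1,4)] order_trans by blast
    moreover have "(G x - G y) $ i \<le> 0"
      using x(3) by (simp add: less_eq_vec_def)
    ultimately have "\<delta> * norm (x - y) \<le> \<delta> / 2 * norm (x - y)"
      using i unfolding vector_minus_component[of _ "A *v (x - y)"] by linarith
    then show ?thesis
      using \<delta>(1) by (simp add: field_simps)
  qed
  with e(1) that show thesis by blast
qed

text \<open>The step goes from \<open>c\<close> along \<open>- u\<close>, restricted to the coordinates in which \<open>c\<close> and \<open>y\<close> differ.\<close>

lemma M_matrix_descent:
  fixes G :: "real ^ 'n \<Rightarrow> real ^ 'n"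
  assumes deriv: "\<And>x. x \<in> cbox a b \<Longrightarrow> (G has_derivative (\<lambda>h. A x *v h)) (at x within cbox a b)"
    and M: "\<And>x. x \<in> cbox a b \<Longrightarrow> M_matrix (A x)"
    and y: "y \<in> cbox a b" and c: "c \<in> cbox a b" and le: "y \<le> c" "G c \<le> G y" and neq: "c \<noteq> y"
  obtains x where "x \<in> cbox a b" and "y \<le> x" "x \<le> c" and "x \<noteq> y" "x \<noteq> c" and "G x \<le> G y"
proof -
  define J where "J = {i. y $ i < c $ i}"
  obtain j0 where j0: "j0 \<in> J"
    using le(1) neq unfolding J_def less_eq_vec_def vec_eq_iff
    by (metis mem_Collect_eq order_le_less)
  obtain u where u: "\<And>i. 0 < u $ i" "\<And>i. 0 < (A c *v u) $ i"
    using M[OF c] unfolding M_matrix_def by blast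
  define v where "v = (\<chi> i. if i \<in> J then u $ i else 0)"
  define p where "p t = c - t *\<^sub>R v" for t :: real
  \<comment> \<open>For a row in \<open>J\<close>, dropping the coordinates outside \<open>J\<close>
    discards only nonpositive off-diagonal terms, so positivity of the image survives.\<close>
  have Av: "0 < (A c *v v) $ i" if "i \<in> J" for i
  proof -
    have "(A c *v u) $ i \<le> (A c *v v) $ i"
      unfolding matrix_vector_mult_def vec_lambda_beta
    proof (rule sum_mono)
      fix j
      show "A c $ i $ j * u $ j \<le> A c $ i $ j * v $ j"
      proof (cases "j \<in> J")
        case True
        then show ?thesis by (simp add: v_def)
      next
        case False
        with that have "i \<noteq> j" by blast
        then have "A c $ i $ j \<le> 0"
          using M[OF c] by (simp add: M_matrix_def)
        with False u(1)[of j] show ?thesis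
          by (simp add: v_def mult_nonpos_nonneg)
      qed
    qed
    with u(2)[of i] show ?thesis by linarith
  qed
  have "\<forall>\<^sub>F t in at_right 0. t * u $ i < c $ i - y $ i" if "i \<in> J" for i
  proof -
    have "((\<lambda>t. t * u $ i) \<longlongrightarrow> 0 * u $ i) (at_right 0)"
      by (intro tendsto_intros)
    then show ?thesis
      by (rule order_tendstoD(2)) (use that in \<open>simp add: J_def\<close>)
  qed
  then have "\<forall>\<^sub>F t in at_right 0. \<forall>i\<in>J. t * u $ i < c $ i - y $ i"
    by (simp add: eventually_ball_finite)
  then obtain \<tau> where \<tau>: "0 < \<tau>"
    "\<And>t i. 0 < t \<Longrightarrow> t < \<tau> \<Longrightarrow> i \<in> J \<Longrightarrow> t * u $ i < c $ i - y $ i"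
    unfolding eventually_at_right_field by blast
  have p_bounds: "y \<le> p t" "p t \<le> c" if "t \<in> {0..<\<tau>}" for t
  proof -
    have *: "t * u $ i < c $ i - y $ i" if "i \<in> J" for i
      using \<tau>(2)[of t i] \<open>t \<in> {0..<\<tau>}\<close> that by (cases "t = 0") (auto simp: J_def)
    show "y \<le> p t"
      unfolding less_eq_vec_def
    proof
      show "y $ i \<le> p t $ i" for i
        using *[of i] le(1) by (auto simp: p_def v_def less_eq_vec_def)
    qed
    show "p t \<le> c"
      using that u(1) by (simp add: p_def v_def less_eq_vec_def less_imp_le)
  qed
  have p_box: "p t \<in> cbox a b" if "t \<in> {0..<\<tau>}" for t
    using p_bounds[OF that] y c unfolding interval_cbox_cart[symmetric] atLeastAtMost_iff
    by (meson order_trans)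
  \<comment> \<open>The derivative of \<open>G\<close> is available only within the box. The path
    stays there for \<open>t\<close> in \<open>[0, \<tau>)\<close>, which gives the right derivative
    \<open>- (A c *v v) $ i < 0\<close> at \<open>0\<close>.\<close>
  have "\<forall>\<^sub>F t in at_right 0. G (p t) $ i < G c $ i" if "i \<in> J" for i
  proof -
    have "(G has_derivative (\<lambda>h. A c *v h)) (at (p 0) within p ` {0..<\<tau>})"
    proof -
      have "p ` {0..<\<tau>} \<subseteq> cbox a b"
        using p_box by blast
      moreover have "p 0 = c"
        by (simp add: p_def)
      ultimately show ?thesis
        using has_derivative_subset[OF deriv[OF c]] by simp
    qed
    moreover have "(p has_derivative (\<lambda>h. - (h *\<^sub>R v))) (at 0 within {0..<\<tau>})"
      unfolding p_def by (auto intro!: derivative_eq_intros)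
    ultimately have "((\<lambda>t. G (p t)) has_derivative (\<lambda>h. A c *v (- (h *\<^sub>R v)))) (at 0 within {0..<\<tau>})"
      by (rule has_derivative_in_compose[rotated])
    from bounded_linear.has_derivative[OF bounded_linear_vec_nth this, of i]
    have "((\<lambda>t. G (p t) $ i) has_real_derivative - (A c *v v) $ i) (at 0 within {0..<\<tau>})"
      unfolding has_field_derivative_def
      by (rule has_derivative_eq_rhs)
        (auto simp: matrix_vector_mult_scaleR linear_neg[OF matrix_vector_mul_linear])
    from has_real_derivative_neg_dec_right[OF this] Av[OF that]
    obtain d where d: "0 < d" "\<And>h. 0 < h \<Longrightarrow> h \<in> {0..<\<tau>} \<Longrightarrow> h < d \<Longrightarrow> G (p h) $ i < G (p 0) $ i"
      by auto
    show ?thesis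
      unfolding eventually_at_right_field
      by (rule exI[of _ "min d \<tau>"]) (use d \<tau>(1) in \<open>auto simp: p_def\<close>)
  qed
  then have "\<forall>\<^sub>F t in at_right 0. \<forall>i\<in>J. G (p t) $ i < G c $ i"
    by (simp add: eventually_ball_finite)
  moreover have "\<forall>\<^sub>F t in at_right 0. t \<in> {0<..<\<tau>}"
    using \<tau>(1) by (rule eventually_at_right_real)
  ultimately have "\<forall>\<^sub>F t in at_right 0. t \<in> {0<..<\<tau>} \<and> (\<forall>i\<in>J. G (p t) $ i < G c $ i)"
    by eventually_elim auto
  then obtain t where t: "t \<in> {0<..<\<tau>}" "\<And>i. i \<in> J \<Longrightarrow> G (p t) $ i < G c $ i"
    using eventually_happens'[OF trivial_limit_at_right_real] by blast
  have "G (p t) $ i \<le> G y $ i" for i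
  proof (cases "i \<in> J")
    case True
    then show ?thesis
      using t(2)[OF True] le(2) by (meson less_eq_vec_def less_imp_le order_trans)
  next
    \<comment> \<open>These coordinates did not move and agree with those of \<open>y\<close>, so
      the comparison is with \<open>y\<close> directly, not with \<open>c\<close>.\<close>
    case False
    then have "y $ i = p t $ i"
      using le(1) by (auto simp: p_def v_def J_def less_eq_vec_def intro: order_antisym)
    then show ?thesis
      using t(1) p_box p_bounds y M
      by (intro box_off_diagonal_antitone[OF deriv]) (auto simp: M_matrix_def)
  qed
  moreover have "p t $ j0 \<noteq> y $ j0"
    using \<tau>(2)[of t j0] t(1) j0 by (auto simp: p_def v_def)
  moreover have "p t $ j0 \<noteq> c $ j0"
    using u(1)[of j0] t(1) j0 by (auto simp: p_def v_def)
  ultimately show thesis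
    using that[of "p t"] p_box[of t] p_bounds[of t] t(1) by (auto simp: less_eq_vec_def)
qed

proposition M_matrix_inverse_isotone:
  fixes G :: "real ^ 'n \<Rightarrow> real ^ 'n"
  assumes deriv: "\<And>x. x \<in> cbox a b \<Longrightarrow> (G has_derivative (\<lambda>h. A x *v h)) (at x within cbox a b)"
    and M: "\<And>x. x \<in> cbox a b \<Longrightarrow> M_matrix (A x)"
    and x: "x \<in> cbox a b" and y: "y \<in> cbox a b" and le: "G x \<le> G y"
  shows "x \<le> y"
proof -
  \<comment> \<open>Off-diagonal antitonicity gives \<open>G z \<le> G y\<close> for \<open>z = sup x y\<close>. The set of \<open>w \<ge> y\<close> other than \<open>y\<close>
    with \<open>G w \<le> G y\<close> is compact, as \<open>y\<close> is isolated from it, and by the descent lemma it has no point of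
    minimal coordinate sum; hence it is empty and \<open>z = y\<close>.\<close>
  define z where "z = sup x y"
  have z: "z $ i = max (x $ i) (y $ i)" for i
    by (simp add: z_def sup_vec_def sup_max)
  have z_box: "z \<in> cbox a b"
    using x y by (auto simp: mem_box_cart z le_max_iff_disj)
  have "y \<le> z" "x \<le> z"
    by (simp_all add: z_def)
  have G_z: "G z \<le> G y"
    unfolding less_eq_vec_def
  proof
    fix i
    show "G z $ i \<le> G y $ i"
    proof (cases "x $ i \<le> y $ i")
      case True
      then show ?thesis
        using \<open>y \<le> z\<close> y z_box M
        by (intro box_off_diagonal_antitone[OF deriv]) (auto simp: M_matrix_def z)
    next
      case False
      then have "G z $ i \<le> G x $ i"
        using \<open>x \<le> z\<close> x z_box M
        by (intro box_off_diagonal_antitone[OF deriv]) (auto simp: M_matrix_def z)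
      then show ?thesis
        using le by (meson less_eq_vec_def order_trans)
    qed
  qed
  have "z = y"
  proof (rule ccontr)
    assume "z \<noteq> y"
    obtain e where e: "0 < e" "\<And>x. x \<in> cbox a b \<Longrightarrow> y \<le> x \<Longrightarrow> G x \<le> G y \<Longrightarrow> norm (x - y) < e \<Longrightarrow> x = y"
      using M_matrix_locally_inverse_isotone[OF deriv[OF y] M[OF y]] by blast
    \<comment> \<open>Removing an open ball instead of the point \<open>y\<close> keeps
      \<open>X\<close> closed; by the choice of \<open>e\<close> no other candidate is lost.\<close>
    define X where "X = {x \<in> cbox a b. \<forall>i. G x $ i \<le> G y $ i} \<inter> ({x. \<forall>i. y $ i \<le> x $ i} \<inter> - ball y e)"
    have X_iff: "x \<in> X \<longleftrightarrow> x \<in> cbox a b \<and> y \<le> x \<and> x \<noteq> y \<and> G x \<le> G y" for x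
      using e by (auto simp: X_def less_eq_vec_def dist_norm norm_minus_commute not_less)
        (metis (no_types, opaque_lifting) e(2) less_eq_vec_def not_le)+
    have "continuous_on (cbox a b) G"
      using deriv by (intro has_derivative_continuous_on)
    then have "closed {x \<in> cbox a b. G x $ i \<le> G y $ i}" for i
      by (intro continuous_on_closed_Collect_le continuous_intros closed_cbox)
    then have "closed (\<Inter>i. {x \<in> cbox a b. G x $ i \<le> G y $ i})"
      by blast
    then have "closed {x \<in> cbox a b. \<forall>i. G x $ i \<le> G y $ i}"
      by (rule back_subst[of closed]) auto
    moreover have "closed ({x. \<forall>i. y $ i \<le> x $ i} \<inter> - ball y e)"
      by (intro closed_Int closed_Collect_all closed_halfspace_component_ge_cart) auto
    ultimately have "closed X"
      unfolding X_def by (rule closed_Int)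
    then have "compact (cbox a b \<inter> X)"
      by (intro compact_Int_closed compact_cbox)
    moreover have "cbox a b \<inter> X = X"
      by (auto simp: X_def)
    ultimately have "compact X"
      by simp
    moreover have "z \<in> X"
      using X_iff z_box \<open>y \<le> z\<close> \<open>z \<noteq> y\<close> G_z by blast
    moreover have "continuous_on X (\<lambda>x. \<Sum>i\<in>UNIV. x $ i)"
      by (intro continuous_intros)
    ultimately obtain c where c: "c \<in> X" "\<And>x. x \<in> X \<Longrightarrow> (\<Sum>i\<in>UNIV. c $ i) \<le> (\<Sum>i\<in>UNIV. x $ i)"
      using continuous_attains_inf[of X] by blast
    then obtain x where "x \<in> X" "x \<le> c" "x \<noteq> c"
      using M_matrix_descent[OF deriv M y, of c] unfolding X_iff by metis
    then have "(\<Sum>i\<in>UNIV. x $ i) < (\<Sum>i\<in>UNIV. c $ i)"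
      by (intro sum_strict_mono_ex1) (auto simp: less_eq_vec_def vec_eq_iff order_less_le)
    with c(2) \<open>x \<in> X\<close> show False by force
  qed
  with \<open>x \<le> z\<close> show ?thesis by simp
qed

section \<open>Sign flip between the type-K order and the componentwise order\<close>

definition K_sign :: "'n set \<Rightarrow> 'n \<Rightarrow> real" where
  "K_sign H i = (if i \<in> H then 1 else - 1)"

definition K_flip :: "'n::finite set \<Rightarrow> real ^ 'n \<Rightarrow> real ^ 'n" where
  "K_flip H x = (\<chi> i. K_sign H i * x $ i)"

lemma K_sign_mult_self [simp]: "K_sign H i * K_sign H i = 1" "K_sign H i * (K_sign H i * c) = c"
  by (simp_all add: K_sign_def)

lemma K_flip_component [simp]: "K_flip H x $ i = K_sign H i * x $ i"
  by (simp add: K_flip_def)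

lemma K_flip_flip [simp]: "K_flip H (K_flip H x) = x"
  by (simp add: vec_eq_iff)

lemma bounded_linear_K_flip: "bounded_linear (K_flip H)"
  unfolding K_flip_def
  by (intro linear_conv_bounded_linear[THEN iffD1] linearI) (auto simp: vec_eq_iff algebra_simps)

text \<open>\<open>K_flip H\<close> maps \<open>cone_K H\<close> linearly onto the nonnegative
  orthant.\<close>

lemma le_K_iff_K_flip: "le_K H x y \<longleftrightarrow> K_flip H x \<le> K_flip H y"
  by (auto simp: le_K_def cone_K_def less_eq_vec_def K_sign_def)

lemma le_K_antisym: "le_K H x y \<Longrightarrow> le_K H y x \<Longrightarrow> x = y"
  unfolding le_K_iff_K_flip by (metis K_flip_flip antisym)

lemma less_K_components:
  assumes "less_K H x y"
  shows "i \<in> H \<Longrightarrow> x $ i \<le> y $ i" and "i \<notin> H \<Longrightarrow> y $ i \<le> x $ i"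
  using assms by (auto simp: less_K_def le_K_def cone_K_def)

lemma order_box_eq_cbox: "order_box r = cbox 0 r"
  by (auto simp: order_box_def mem_box_cart)

section \<open>Jacobian of the growth map\<close>

text \<open>Product rule for \<open>x $ i * f x $ i\<close>; where \<open>f x\<close> is positive,
  this is the diagonal matrix of \<open>f x\<close> times
  \<open>mat 1 - matrix_M f x\<close>.\<close>

definition growth_jacobian :: "(real ^ 'n \<Rightarrow> real ^ 'n) \<Rightarrow> real ^ 'n \<Rightarrow> real ^ 'n ^ 'n::finite" where
  "growth_jacobian f x =
     (\<chi> i j. (if i = j then f x $ i else 0) + x $ i * orthant_jacobian f x $ i $ j)"

lemma growth_jacobian_mult:
  "(growth_jacobian f x *v h) $ i = f x $ i * h $ i + x $ i * (orthant_jacobian f x *v h) $ i"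
proof -
  have "growth_jacobian f x $ i $ j * h $ j
      = (if i = j then f x $ i * h $ j else 0) + x $ i * (orthant_jacobian f x $ i $ j * h $ j)" for j
    by (simp add: growth_jacobian_def algebra_simps)
  then show ?thesis
    by (simp add: matrix_vector_mult_def sum.distrib sum_distrib_left)
qed

lemma growth_map_has_derivative:
  fixes f T :: "real ^ 'n::finite \<Rightarrow> real ^ 'n"
  assumes f: "f differentiable_on nonneg_orthant"
    and T: "\<And>x i. x \<in> nonneg_orthant \<Longrightarrow> T x $ i = x $ i * f x $ i"
    and x: "x \<in> nonneg_orthant"
  shows "(T has_derivative (\<lambda>h. growth_jacobian f x *v h)) (at x within nonneg_orthant)"
proof -
  have "(f has_derivative (\<lambda>h. orthant_jacobian f x *v h)) (at x within nonneg_orthant)"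
    using f x unfolding orthant_jacobian_def differentiable_on_def by (simp add: jacobian_works)
  then have f_i: "((\<lambda>x. f x $ i) has_derivative (\<lambda>h. (orthant_jacobian f x *v h) $ i))
      (at x within nonneg_orthant)" for i
    by (rule bounded_linear.has_derivative[OF bounded_linear_vec_nth])
  have "((\<lambda>x. T x $ i) has_derivative (\<lambda>h. (growth_jacobian f x *v h) $ i))
      (at x within nonneg_orthant)" for i
  proof (rule has_derivative_transform[OF x T])
    show "((\<lambda>x. x $ i * f x $ i) has_derivative (\<lambda>h. (growth_jacobian f x *v h) $ i))
        (at x within nonneg_orthant)"
      by (rule has_derivative_eq_rhs[OF has_derivative_mult[OF
            bounded_linear_imp_has_derivative[OF bounded_linear_vec_nth] f_i]])
        (simp add: growth_jacobian_mult fun_eq_iff)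
  qed
  then show ?thesis
    unfolding has_derivative_componentwise_within[of T] by (auto simp: Basis_vec_def inner_axis)
qed

text \<open>Condenses the block pattern: conjugation by the signs turns all four blocks
  nonpositive.\<close>

lemma type_K_competitive_sign:
  assumes "type_K_competitive H f" and "x \<in> nonneg_orthant"
  shows "K_sign H i * orthant_jacobian f x $ i $ j * K_sign H j \<le> 0"
  using assms by (auto simp: type_K_competitive_def K_sign_def)

text \<open>The matrix is the diagonal matrix of \<open>f x\<close> times \<open>mat 1 - P\<close>,
  where \<open>P\<close> is \<open>matrix_M f x\<close> conjugated by the signs: nonnegative by
  competitiveness, with unchanged eigenvalues. The positive \<open>u\<close> with
  \<open>u - P *v u = 1\<close> is therefore sent to \<open>f x\<close>.\<close>

lemma M_matrix_flipped_growth_jacobian: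
  fixes f :: "real ^ 'n::finite \<Rightarrow> real ^ 'n"
  assumes comp: "type_K_competitive H f" and x: "x \<in> nonneg_orthant"
    and f_pos: "\<And>i. 0 < f x $ i" and radius: "spectral_radius (matrix_M f x) < 1"
  shows "M_matrix (\<chi> i j. K_sign H i * growth_jacobian f x $ i $ j * K_sign H j)" (is "M_matrix ?A")
proof -
  let ?s = "K_sign H"
  define M where "M = matrix_M f x"
  define P where "P = (\<chi> i j. ?s i * M $ i $ j * ?s j)"
  have P_eq: "P $ i $ j = - (x $ i / f x $ i) * (?s i * orthant_jacobian f x $ i $ j * ?s j)" for i j
    by (simp add: P_def M_def matrix_M_def)
  have P_nonneg: "0 \<le> P $ i $ j" for i j
  proof -
    have "- (x $ i / f x $ i) \<le> 0"
      using x f_pos[of i] by (simp add: nonneg_orthant_def)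
    then show ?thesis
      unfolding P_eq using type_K_competitive_sign[OF comp x] by (rule mult_nonpos_nonpos)
  qed
  have no_eigenvalue: "v = 0" if "1 \<le> c" and v: "P *v v = c *s v" for c v
  proof (rule ccontr)
    assume "v \<noteq> 0"
    \<comment> \<open>The flip undoes the conjugation: an eigenvector of \<open>P\<close> becomes
      one of \<open>M\<close> for the same \<open>c\<close>.\<close>
    have "(M *v K_flip H v) $ i = (c *s K_flip H v) $ i" for i
    proof -
      have "(M *v K_flip H v) $ i = ?s i * (P *v v) $ i"
        by (simp add: P_def matrix_vector_mult_def sum_distrib_left mult.assoc)
      then show ?thesis
        by (simp add: v)
    qed
    then have "M *v K_flip H v = c *s K_flip H v"
      unfolding vec_eq_iff by blast
    moreover have "K_flip H v \<noteq> 0"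
      using \<open>v \<noteq> 0\<close> by (auto simp: vec_eq_iff K_sign_def)
    ultimately have "cmod (complex_of_real c) \<le> spectral_radius M"
      by (intro cmod_le_spectral_radius real_eigenvalue_in_complex_spectrum)
    with \<open>1 \<le> c\<close> radius show False
      by (simp add: M_def)
  qed
  obtain u where u: "\<And>i. 0 < u $ i" "u - P *v u = 1"
    using P_nonneg no_eigenvalue nonneg_matrix_resolvent[of P] by metis
  have A_eq: "?A $ i $ j = f x $ i * ((if i = j then 1 else 0) - P $ i $ j)" for i j
    using f_pos[of i] by (simp add: growth_jacobian_def P_eq field_simps)
  have "?A $ i $ j * u $ j
      = (if i = j then f x $ i * u $ j else 0) - f x $ i * (P $ i $ j * u $ j)" for i j
    unfolding A_eq by (simp add: algebra_simps)
  then have "(?A *v u) $ i = f x $ i * (u - P *v u) $ i" for i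
    unfolding matrix_vector_mult_def[of ?A] vec_lambda_beta[of "\<lambda>i. \<Sum>j\<in>UNIV. ?A $ i $ j * u $ j"]
    by (simp add: matrix_vector_mult_def sum_subtractf sum_distrib_left right_diff_distrib)
  then have "0 < (?A *v u) $ i" for i
    using f_pos u(2) by simp
  moreover have "?A $ i $ j \<le> 0" if "i \<noteq> j" for i j
    unfolding A_eq using that P_nonneg[of i j] f_pos[of i] by (simp add: less_imp_le)
  ultimately show ?thesis
    unfolding M_matrix_def using u(1) by blast
qed

section \<open>Order properties of the growth map on the box\<close>

locale type_K_growth =
  fixes f T :: "real ^ 'n::finite \<Rightarrow> real ^ 'n" and r :: "real ^ 'n" and H :: "'n set"
  assumes f_differentiable: "f differentiable_on nonneg_orthant"
    and f_pos: "\<And>x i. x \<in> nonneg_orthant \<Longrightarrow> 0 < f x $ i"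
    and T_eq: "\<And>x i. x \<in> nonneg_orthant \<Longrightarrow> T x $ i = x $ i * f x $ i"
    and competitive: "type_K_competitive H f"
    and radius: "\<And>x. x \<in> order_box r \<Longrightarrow> spectral_radius (matrix_M f x) < 1"
begin

lemma order_box_subset: "order_box r \<subseteq> nonneg_orthant"
  by (auto simp: order_box_def nonneg_orthant_def)

lemma T_has_derivative:
  "x \<in> order_box r \<Longrightarrow>
    (T has_derivative (\<lambda>h. growth_jacobian f x *v h)) (at x within order_box r)"
  using growth_map_has_derivative[OF f_differentiable T_eq] order_box_subset
  by (meson has_derivative_subset subsetD)

text \<open>The flip carries the box to a box on which the conjugated map \<open>G\<close> has
  M-matrix derivatives; its inverse isotonicity is then translated back.\<close>

lemma T_inverse_isotone:
  assumes x: "x \<in> order_box r" and y: "y \<in> order_box r" and le: "le_K H (T x) (T y)"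
  shows "le_K H x y"
proof -
  let ?s = "K_sign H"
  \<comment> \<open>Corners of the flipped box: outside \<open>H\<close> the range
    \<open>[0, r $ i]\<close> becomes \<open>[- r $ i, 0]\<close>.\<close>
  define a where "a = (\<chi> i. if i \<in> H then 0 else - r $ i)"
  define b where "b = (\<chi> i. if i \<in> H then r $ i else 0)"
  define G where "G = (\<lambda>w. K_flip H (T (K_flip H w)))"
  define A where "A = (\<lambda>w. \<chi> i j. ?s i * growth_jacobian f (K_flip H w) $ i $ j * ?s j)"
  have box_iff: "w \<in> cbox a b \<longleftrightarrow> K_flip H w \<in> order_box r" for w
  proof -
    have "a $ i \<le> w $ i \<and> w $ i \<le> b $ i \<longleftrightarrow> 0 \<le> K_flip H w $ i \<and> K_flip H w $ i \<le> r $ i" for i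
      by (auto simp: a_def b_def K_sign_def)
    then show ?thesis
      unfolding mem_box_cart order_box_def by blast
  qed
  have deriv: "(G has_derivative (\<lambda>h. A w *v h)) (at w within cbox a b)" if w: "w \<in> cbox a b" for w
  proof -
    have "(T has_derivative (\<lambda>h. growth_jacobian f (K_flip H w) *v h))
        (at (K_flip H w) within K_flip H ` cbox a b)"
      using w box_iff by (intro has_derivative_subset[OF T_has_derivative]) auto
    then have "((\<lambda>w. T (K_flip H w)) has_derivative
        (\<lambda>h. growth_jacobian f (K_flip H w) *v K_flip H h)) (at w within cbox a b)"
      by (rule has_derivative_in_compose[rotated])
        (rule bounded_linear_imp_has_derivative[OF bounded_linear_K_flip])
    then have "(G has_derivative (\<lambda>h. K_flip H (growth_jacobian f (K_flip H w) *v K_flip H h)))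
        (at w within cbox a b)"
      unfolding G_def by (rule bounded_linear.has_derivative[OF bounded_linear_K_flip])
    moreover have "K_flip H (growth_jacobian f (K_flip H w) *v K_flip H h) = A w *v h" for h
      by (simp add: A_def vec_eq_iff matrix_vector_mult_def sum_distrib_left mult.assoc)
    ultimately show ?thesis
      by simp
  qed
  have M: "M_matrix (A w)" if "w \<in> cbox a b" for w
    unfolding A_def using that box_iff order_box_subset
    by (intro M_matrix_flipped_growth_jacobian competitive f_pos radius) auto
  have "K_flip H x \<le> K_flip H y"
    using M_matrix_inverse_isotone[OF deriv M, of "K_flip H x" "K_flip H y"] x y le
    by (simp add: box_iff G_def le_K_iff_K_flip)
  then show ?thesis
    by (simp add: le_K_iff_K_flip)
qed

lemma T_inj_on: "inj_on T (order_box r)"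
proof (rule inj_onI)
  fix x y assume "x \<in> order_box r" "y \<in> order_box r" "T x = T y"
  then show "x = y"
    using T_inverse_isotone[of x y] T_inverse_isotone[of y x]
    by (intro le_K_antisym[of H]) (auto simp: le_K_iff_K_flip)
qed

text \<open>A continuous injection on a compact set is a homeomorphism onto its image.\<close>

lemma T_homeomorphism: "\<exists>g. homeomorphism (order_box r) (T ` order_box r) T g"
proof (rule homeomorphism_compact)
  show "continuous_on (order_box r) T"
    using T_has_derivative by (rule has_derivative_continuous_on)
qed (simp_all add: order_box_eq_cbox T_inj_on[unfolded order_box_eq_cbox])

text \<open>At a coordinate where \<open>x\<close> and \<open>y\<close> agree, only the off-diagonal entries of the Jacobian
  contribute, and they have the competitive sign.\<close>

lemma T_tie:
  assumes x: "x \<in> order_box r" and y: "y \<in> order_box r" and le: "le_K H x y" and tie: "x $ i = y $ i"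
  shows "K_sign H i * T y $ i \<le> K_sign H i * T x $ i"
    and "\<lbrakk>\<And>z j. z \<in> order_box r \<Longrightarrow> orthant_jacobian f z $ i $ j \<noteq> 0; x \<noteq> y; x $ i \<noteq> 0\<rbrakk>
      \<Longrightarrow> K_sign H i * T y $ i < K_sign H i * T x $ i"
proof -
  let ?s = "K_sign H"
  obtain z where z: "z \<in> closed_segment x y"
    and mv: "T y $ i - T x $ i = (growth_jacobian f z *v (y - x)) $ i"
    using box_mean_value[OF T_has_derivative[unfolded order_box_eq_cbox], where x = x and y = y and i = i]
      x y unfolding order_box_eq_cbox by blast
  have z_box: "z \<in> order_box r"
    using z x y unfolding order_box_eq_cbox by (meson closed_segment_subset convex_box(1) subsetD)
  then have z_orthant: "z \<in> nonneg_orthant"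
    using order_box_subset by blast
  obtain t where "z = (1 - t) *\<^sub>R x + t *\<^sub>R y"
    using z by (auto simp: in_segment)
  \<comment> \<open>All points of the segment share coordinate \<open>i\<close>, so the weight in
    row \<open>i\<close> of the Jacobian at \<open>z\<close> is \<open>x $ i\<close>.\<close>
  then have z_i: "z $ i = x $ i"
    using tie by (simp add: left_diff_distrib)
  \<comment> \<open>The sign of \<open>j\<close> is inserted twice, making the first factor
    nonpositive and the second nonnegative.\<close>
  define q where "q j = (?s i * orthant_jacobian f z $ i $ j * ?s j) * (?s j * (y - x) $ j)" for j
  have "?s i * (T y $ i - T x $ i) = ?s i * (x $ i * (orthant_jacobian f z *v (y - x)) $ i)"
    by (simp add: mv growth_jacobian_mult tie z_i)
  also have "\<dots> = x $ i * (\<Sum>j\<in>UNIV. q j)"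
    by (simp add: q_def matrix_vector_mult_def sum_distrib_left mult_ac)
  finally have diff: "?s i * T y $ i - ?s i * T x $ i = x $ i * (\<Sum>j\<in>UNIV. q j)"
    by (simp add: algebra_simps)
  have flip_nonneg: "0 \<le> ?s j * (y - x) $ j" for j
    using le by (simp add: le_K_iff_K_flip less_eq_vec_def algebra_simps)
  then have q_nonpos: "q j \<le> 0" for j
    unfolding q_def by (intro mult_nonpos_nonneg type_K_competitive_sign[OF competitive z_orthant])
  have x_i: "0 \<le> x $ i"
    using x by (simp add: order_box_def)
  have "x $ i * (\<Sum>j\<in>UNIV. q j) \<le> 0"
    using x_i q_nonpos by (intro mult_nonneg_nonpos sum_nonpos)
  then show "?s i * T y $ i \<le> ?s i * T x $ i"
    using diff by linarith
  show "?s i * T y $ i < ?s i * T x $ i"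
    if nz: "\<And>z j. z \<in> order_box r \<Longrightarrow> orthant_jacobian f z $ i $ j \<noteq> 0"
      and "x \<noteq> y" and "x $ i \<noteq> 0"
  proof -
    obtain j where "x $ j \<noteq> y $ j"
      using \<open>x \<noteq> y\<close> by (auto simp: vec_eq_iff)
    then have "q j \<noteq> 0"
      using nz[OF z_box] by (simp add: q_def K_sign_def)
    then have "\<exists>j\<in>UNIV. q j < 0"
      using q_nonpos by (auto simp: order_less_le)
    with q_nonpos have "(\<Sum>j\<in>UNIV. q j) < (\<Sum>j\<in>(UNIV :: 'n set). 0)"
      by (intro sum_strict_mono_ex1 ballI) auto
    then have "x $ i * (\<Sum>j\<in>UNIV. q j) < 0"
      using x_i \<open>x $ i \<noteq> 0\<close> by (simp add: mult_pos_neg)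
    then show ?thesis
      using diff by linarith
  qed
qed

lemma less_K_T_imp_less_K:
  assumes "x \<in> order_box r" and "y \<in> order_box r" and "less_K H (T x) (T y)"
  shows "less_K H x y"
  using assms T_inverse_isotone by (auto simp: less_K_def)

text \<open>A tie \<open>x $ i = y $ i\<close> lets coordinate \<open>i\<close> of \<open>T\<close>
  move only against the type-K order, so a strict increase in that order excludes ties;
  \<open>less_K H x y\<close> then fixes the direction.\<close>

lemma T_weakly_type_K_retrotone: "weakly_type_K_retrotone_on H (order_box r) T"
  unfolding weakly_type_K_retrotone_on_def
proof (intro ballI impI)
  fix x y assume x: "x \<in> order_box r" and y: "y \<in> order_box r" and T_less: "less_K H (T x) (T y)"
  have less: "less_K H x y"
    using less_K_T_imp_less_K[OF x y T_less] .
  have no_tie: "x $ i \<noteq> y $ i" if "K_sign H i * T x $ i < K_sign H i * T y $ i" for i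
    using T_tie(1)[OF x y, of i] less that by (auto simp: less_K_def)
  have "x $ i < y $ i" if "i \<in> H" "T x $ i < T y $ i" for i
    using no_tie[of i] less_K_components(1)[OF less that(1)] that by (simp add: K_sign_def)
  moreover have "y $ i < x $ i" if "i \<notin> H" "T y $ i < T x $ i" for i
    using no_tie[of i] less_K_components(2)[OF less that(1)] that by (simp add: K_sign_def)
  ultimately show "less_K H x y \<and> (\<forall>i\<in>H. T x $ i < T y $ i \<longrightarrow> x $ i < y $ i) \<and>
      (\<forall>j\<in>-H. T y $ j < T x $ j \<longrightarrow> y $ j < x $ j)"
    using less by simp
qed

text \<open>With no vanishing partial derivative, a tie at a nonzero coordinate moves
  \<open>T\<close> strictly against the order, contradicting even the weak inequality between
  \<open>T x\<close> and \<open>T y\<close>.\<close>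

lemma T_type_K_retrotone:
  assumes nz: "\<And>x i j. x \<in> order_box r \<Longrightarrow> orthant_jacobian f x $ i $ j \<noteq> 0"
  shows "type_K_retrotone_on H (order_box r) T"
  unfolding type_K_retrotone_on_def
proof (intro ballI impI)
  fix x y assume x: "x \<in> order_box r" and y: "y \<in> order_box r" and T_less: "less_K H (T x) (T y)"
  have less: "less_K H x y"
    using less_K_T_imp_less_K[OF x y T_less] .
  have no_tie: "x $ i \<noteq> y $ i" if "x $ i \<noteq> 0 \<or> y $ i \<noteq> 0" for i
  proof
    assume tie: "x $ i = y $ i"
    then have "K_sign H i * T y $ i < K_sign H i * T x $ i"
      using that less nz by (intro T_tie(2)[OF x y]) (auto simp: less_K_def)
    moreover have "K_sign H i * T x $ i \<le> K_sign H i * T y $ i"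
      using T_less by (simp add: less_K_def le_K_iff_K_flip less_eq_vec_def)
    ultimately show False
      by linarith
  qed
  have "x $ i < y $ i" if "i \<in> H" "y $ i \<noteq> 0" for i
    using no_tie[of i] less_K_components(1)[OF less that(1)] that(2) by simp
  moreover have "y $ i < x $ i" if "i \<notin> H" "x $ i \<noteq> 0" for i
    using no_tie[of i] less_K_components(2)[OF less that(1)] that(2) by simp
  ultimately show "less_K H x y \<and> (\<forall>i\<in>H. y $ i \<noteq> 0 \<longrightarrow> x $ i < y $ i) \<and>
      (\<forall>j\<in>-H. x $ j \<noteq> 0 \<longrightarrow> y $ j < x $ j)"
    using less by simp
qed

end

theorem proposition2:
  fixes f T :: "real ^ 'n::{finite, linorder} \<Rightarrow> real ^ 'n::{finite, linorder}"
    and r :: "real ^ 'n::{finite, linorder}"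
    and k :: nat
  assumes "CARD('n) \<ge> 2" and "1 \<le> k" and "k < CARD('n)"
    and "f ` nonneg_orthant \<subseteq> nonneg_orthant" and "C1_on_orthant f"
    and "\<And>x i. x \<in> nonneg_orthant \<Longrightarrow> f x $ i > 0"
    and "\<And>x i. x \<in> nonneg_orthant \<Longrightarrow> T x $ i = x $ i * f x $ i"
    and "r \<in> pos_orthant"
    and "type_K_competitive (first_indices k) f"
    and "type_K_convex (first_indices k) (T ` order_box r)"
    and "\<And>x. x \<in> order_box r \<Longrightarrow> spectral_radius (matrix_M f x) < 1"
  shows "(\<exists>g. homeomorphism (order_box r) (T ` order_box r) T g)
    \<and> weakly_type_K_retrotone_on (first_indices k) (order_box r) T
    \<and> ((\<forall>x\<in>order_box r. \<forall>i j. orthant_jacobian f x $ i $ j \<noteq> 0)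
        \<longrightarrow> type_K_retrotone_on (first_indices k) (order_box r) T)"
proof -
  interpret type_K_growth f T r "first_indices k"
    using assms by unfold_locales (auto simp: C1_on_orthant_def)
  show ?thesis
    using T_homeomorphism T_weakly_type_K_retrotone T_type_K_retrotone by blast
qed

end
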